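(* In the Error-in-Operator setup of the context, let $N_1\ge N_2\ge\dots\ge N_p>0$ be the ordered eigenvalues of $D^2={A^*}^\top A^*$ with orthonormal eigenvectors $e_1,\dots,e_p$, and let $G^2=G_J^2$ be the spectral cut-off penalty at $J$, that is, $G_J^2=\operatorname{diag}\{g_1^2,\dots,g_p^2\}$ in the basis $(e_j)$ with $g_j^2=0$ for $j\le J$ and $g_j^2=\infty$ for $j>J$. Let $\Pi_J$ be the orthogonal projector in $\mathbb R^p$ onto the span of $e_1,\dots,e_J$. Then $$\operatorname{tr}\bigl\{(\kappa^{-2}D^2+G^2)^{-1}\bigr\}=\kappa^4\sum_{j=1}^J\frac1{N_j},\qquad \|(\mathcal F_{\mathcal G}^{-1}\mathcal G^2\upsilon^* )_\theta\|^2=\|(I_p-\Pi_J)\theta^*\|^2,$$ yielding for $\mathcal R=\operatorname{tr}\operatorname{Var}\{(\mathcal F_{\mathcal G}^{-1}\nabla\zeta)_\theta\}+\|(\mathcal F_{\mathcal G}^{-1}\mathcal G^2\upsilon^* )_\theta\|^2$ $$\mathcal R\lesssim\kappa^4\sum_{j=1}^J\frac1{N_j}+\|(I_p-\Pi_J)\theta^*\|^2 .$$ If moreover, for constants $C_1,C_2$ and every $J$, $\sum_{j=1}^J N_j^{-1}\le C_1J/N_J$ and $\sum_{j=J+1}^pN_j\le C_2JN_J$, and $\sum_{j=1}^pw_j^2\langle\theta^*,e_j\rangle^2\le1$ with positive $w_j$ growing in $j$, then $$\mathcal R\lesssim\frac J{N_J}+\frac1{w_J^2}.$$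
   Context: Setup. $Z$ is a random vector in $\mathbb R^q$, $\hat A$ a random matrix in $\mathbb R^{q\times p}$ (finite second moments), $\mu>0$; $A^*=\mathbb E\hat A$, $\mathbb EZ=A^*\theta^*=z^*$ with $\theta^*\in\mathbb R^p$; $\upsilon^*=(\theta^*,z^*,A^* )$. The full parameter is $\upsilon=(\theta,z,A)\in\mathbb R^p\times\mathbb R^q\times\mathbb R^{q\times p}$ and $$\mathcal L(\upsilon)=-\tfrac12\|Z-z\|^2-\tfrac{\mu^2}2\|A-\hat A\|_{\mathrm{Fr}}^2-\tfrac12\|z-A\theta\|^2 .$$ The operator is not penalized, so the full penalty is $\mathcal G^2=\mathrm{block}\{G^2,0,0\}$. $N=\lambda_{\min}(D^2)$, $\delta_0\le1/10$, $R=\delta_0\mu\sqrt N$, $\kappa=2$; it is assumed that $\upsilon^*$ lies in $\Upsilon^\circ=\{(\theta,z,A):\|D\theta\|\le R,\|z\|\le R,\|(A-A^* )D^{-1}\|_{\mathrm{Fr}}\le\delta_0\}$. $\mathcal F=-\nabla^2\mathbb E\mathcal L(\upsilon^* )$, $\mathcal F_{\mathcal G}=\mathcal F+\mathcal G^2$. Expressions involving infinite penalty coefficients are understood as limits when $g_j^2=g^2\to\infty$ for all $j>J$. The score is $\nabla\zeta=\nabla(\mathcal L-\mathbb E\mathcal L)=(0,\omega,\mu U)$, $\omega=Z-\mathbb EZ$, $U=\mu(\hat A-\mathbb E\hat A)$; $(\cdot)_\theta$ is the $\theta$-component. The noise satisfies $\|\operatorname{Var}(\omega)\|\le C_\omega$,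 $\|\operatorname{Var}(U)\|\le C_\nu$. The symbol $\lesssim$ means inequality up to a constant factor depending only on $\kappa,C_\omega,C_\nu$ and, in the last display, $C_1,C_2$.
   Formalization: The first display is proved with κ² in place of the printed κ⁴: with κ=2, p=q=J=1, A*=1, θ*=0 the trace equals 4, not 16. The risk bounds keep κ⁴. *)

theory Defs
  imports "HOL-Probability.Probability"
begin

text \<open>
  The operator norm is \<^const>\<open>onorm\<close>, and the norm of the library on \<^typ>\<open>real^'p^'q\<close>
  is the Frobenius norm. A full parameter is a triple \<open>(\<theta>, z, A)\<close> in a Euclidean product space,
  whose inner product is the sum of the three (Frobenius, for \<open>A\<close>) inner products, so that
  gradients and Hessians in the full parameter are taken without any vectorisation of \<open>A\<close>.
\<close>

type_synonym ('p, 'q) param = "(real^'p) \<times> (real^'q) \<times> (real^'p^'q)"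

subsection \<open>Differential calculus and linear algebra\<close>

definition grad :: "('a::real_inner \<Rightarrow> real) \<Rightarrow> 'a \<Rightarrow> 'a" where
  "grad f x = (THE D. GDERIV f x :> D)"

text \<open>The Hessian is represented as a linear operator, not as a bilinear form.\<close>

definition hess :: "('a::real_inner \<Rightarrow> real) \<Rightarrow> 'a \<Rightarrow> 'a \<Rightarrow> 'a" where
  "hess f x = frechet_derivative (grad f) (at x)"

definition lambda_min :: "real^'n^'n \<Rightarrow> real" where
  "lambda_min S = Min {l. \<exists>v. v \<noteq> 0 \<and> S *v v = l *\<^sub>R v}"

definition orth_proj :: "'a::real_inner set \<Rightarrow> 'a \<Rightarrow> 'a" where
  "orth_proj S x = (THE y. y \<in> S \<and> (\<forall>v\<in>S. orthogonal (x - y) v))"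

text \<open>
  The variance of a random element \<open>X\<close> of a Euclidean space, as the operator
  \<open>h \<mapsto> E (\<langle>X - E X, h\<rangle> (X - E X))\<close>; for vectors this is the covariance matrix, and for
  random matrices it is the covariance matrix of the vectorisation.
\<close>

definition Var_op :: "'w measure \<Rightarrow> ('w \<Rightarrow> 'a::euclidean_space) \<Rightarrow> 'a \<Rightarrow> 'a" where
  "Var_op M X h = (\<integral>x. ((X x - integral\<^sup>L M X) \<bullet> h) *\<^sub>R (X x - integral\<^sup>L M X) \<partial>M)"

subsection \<open>The error-in-operator model\<close>

definition loglik ::
  "real \<Rightarrow> real^'q \<Rightarrow> real^'p^'q \<Rightarrow> ('p::finite, 'q::finite) param \<Rightarrow> real" where
  "loglik \<mu> Zv Av = (\<lambda>(\<theta>, z, A).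
     - (1/2) * (norm (Zv - z))\<^sup>2 - \<mu>\<^sup>2 / 2 * (norm (A - Av))\<^sup>2 - (1/2) * (norm (z - A *v \<theta>))\<^sup>2)"

definition expected_loglik ::
  "'w measure \<Rightarrow> ('w \<Rightarrow> real^'q) \<Rightarrow> ('w \<Rightarrow> real^'p^'q) \<Rightarrow> real
     \<Rightarrow> ('p::finite, 'q::finite) param \<Rightarrow> real" where
  "expected_loglik M Z Ahat \<mu> \<upsilon> = (\<integral>x. loglik \<mu> (Z x) (Ahat x) \<upsilon> \<partial>M)"

text \<open>
  The gradient at \<open>\<upsilon>\<close> of the stochastic part of the log-likelihood. This part is affine in the
  parameter, so the value does not depend on \<open>\<upsilon>\<close>: it is
  \<open>(0, Z - E Z, \<mu>\<^sup>2 (Ahat - E Ahat))\<close>.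
\<close>

definition score ::
  "'w measure \<Rightarrow> ('w \<Rightarrow> real^'q) \<Rightarrow> ('w \<Rightarrow> real^'p^'q) \<Rightarrow> real
     \<Rightarrow> ('p::finite, 'q::finite) param \<Rightarrow> 'w \<Rightarrow> ('p, 'q) param" where
  "score M Z Ahat \<mu> \<upsilon> x =
     grad (\<lambda>\<upsilon>'. loglik \<mu> (Z x) (Ahat x) \<upsilon>' - expected_loglik M Z Ahat \<mu> \<upsilon>') \<upsilon>"

definition local_set ::
  "real^'p^'q \<Rightarrow> real^'p^'p \<Rightarrow> real \<Rightarrow> real \<Rightarrow> ('p::finite, 'q::finite) param set" where
  "local_set As D \<delta>0 R =
     {(\<theta>, z, A). norm (D *v \<theta>) \<le> R \<and> norm z \<le> R \<and> norm ((A - As) ** matrix_inv D) \<le> \<delta>0}"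

subsection \<open>Spectral cut-off penalty and penalised risk\<close>

text \<open>
  The penalty matrix with the finite value \<open>g2\<close> in place of the infinite coefficients; the
  cut-off itself is the limit \<open>g2 \<longlongrightarrow> \<infinity>\<close>. The eigenbasis \<open>e\<close> is indexed by \<open>1, \<dots>, p\<close>.
\<close>

definition cutoff_penalty :: "(nat \<Rightarrow> real^'p) \<Rightarrow> nat \<Rightarrow> real \<Rightarrow> real^'p^'p" where
  "cutoff_penalty e J g2 =
     (\<chi> a b. \<Sum>j=1..CARD('p). (if j \<le> J then 0 else g2) * (e j $ a) * (e j $ b))"

definition full_penalty :: "real^'p^'p \<Rightarrow> ('p::finite, 'q::finite) param \<Rightarrow> ('p, 'q) param" where
  "full_penalty G2 = (\<lambda>(\<theta>, z, A). (G2 *v \<theta>, 0, 0))"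

definition fisher ::
  "'w measure \<Rightarrow> ('w \<Rightarrow> real^'q) \<Rightarrow> ('w \<Rightarrow> real^'p^'q) \<Rightarrow> real
     \<Rightarrow> ('p::finite, 'q::finite) param \<Rightarrow> ('p, 'q) param \<Rightarrow> ('p, 'q) param" where
  "fisher M Z Ahat \<mu> \<upsilon> h = - hess (expected_loglik M Z Ahat \<mu>) \<upsilon> h"

definition fisher_pen ::
  "'w measure \<Rightarrow> ('w \<Rightarrow> real^'q) \<Rightarrow> ('w \<Rightarrow> real^'p^'q) \<Rightarrow> real
     \<Rightarrow> ('p::finite, 'q::finite) param \<Rightarrow> real^'p^'p \<Rightarrow> ('p, 'q) param \<Rightarrow> ('p, 'q) param" where
  "fisher_pen M Z Ahat \<mu> \<upsilon> G2 h = fisher M Z Ahat \<mu> \<upsilon> h + full_penalty G2 h"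

definition bias_sq ::
  "'w measure \<Rightarrow> ('w \<Rightarrow> real^'q) \<Rightarrow> ('w \<Rightarrow> real^'p^'q) \<Rightarrow> real
     \<Rightarrow> ('p::finite, 'q::finite) param \<Rightarrow> real^'p^'p \<Rightarrow> real" where
  "bias_sq M Z Ahat \<mu> \<upsilon> G2 =
     (norm (fst (inv (fisher_pen M Z Ahat \<mu> \<upsilon> G2) (full_penalty G2 \<upsilon>))))\<^sup>2"

definition risk ::
  "'w measure \<Rightarrow> ('w \<Rightarrow> real^'q) \<Rightarrow> ('w \<Rightarrow> real^'p^'q) \<Rightarrow> real
     \<Rightarrow> ('p::finite, 'q::finite) param \<Rightarrow> real^'p^'p \<Rightarrow> real" where
  "risk M Z Ahat \<mu> \<upsilon> G2 =
     trace (matrix (Var_op M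
       (\<lambda>x. fst (inv (fisher_pen M Z Ahat \<mu> \<upsilon> G2) (score M Z Ahat \<mu> \<upsilon> x)))))
     + bias_sq M Z Ahat \<mu> \<upsilon> G2"

subsection \<open>Constants\<close>

text \<open>
  The constants hidden in \<open>\<lesssim>\<close> must be uniform in the dimensions \<open>p\<close>, \<open>q\<close> and in the probability
  space, which are types here; a constant bound by an existential quantifier inside a statement
  could depend on these types. Being closed terms without type parameters, the two functions
  below cannot. No attempt is made at sharpness.
\<close>

definition C_risk :: "real \<Rightarrow> real \<Rightarrow> real" where
  "C_risk C\<^sub>\<omega> C\<^sub>\<nu> = 1 + 2 * C\<^sub>\<omega> + 2 * C\<^sub>\<nu>"

definition C_rate :: "real \<Rightarrow> real \<Rightarrow> real \<Rightarrow> real \<Rightarrow> real \<Rightarrow> real" where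
  "C_rate \<kappa> C\<^sub>\<omega> C\<^sub>\<nu> C1 C2 = C_risk C\<^sub>\<omega> C\<^sub>\<nu> * (1 + \<kappa>^4 * \<bar>C1\<bar> + \<bar>C2\<bar>)"

end

theory Submission
  imports Defs
begin

text \<open>
  At the true parameter the residual \<open>z - A \<theta>\<close> vanishes, so the Hessian of the expected
  log-likelihood there has no second-order terms from the product \<open>A \<theta>\<close> and the equation
  \<open>F\<^sub>G h = (a, b, C)\<close> can be solved by hand. Its last two components express the increments of \<open>z\<close>
  and \<open>A\<close> through one residual vector, and eliminating it leaves an equation for the increment \<open>t\<close>
  of \<open>\<theta>\<close> alone:
  \<open>(D\<^sup>2 + c G\<^sup>2) t = c a + A\<^sup>T (b - C \<theta> / \<mu>\<^sup>2)\<close> with \<open>c = 2 + \<parallel>\<theta>\<parallel>\<^sup>2 / \<mu>\<^sup>2\<close>.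
  The matrices \<open>D\<^sup>2\<close> and \<open>G\<^sup>2\<close> are both diagonal in the basis \<open>e\<close>, so with the finite value \<open>g\<close> for the
  penalty every coordinate of \<open>t\<close> is an explicit fraction with denominator \<open>N\<^sub>j\<close> for \<open>j \<le> J\<close> and
  \<open>N\<^sub>j + c g\<close> for \<open>j > J\<close> (\<open>fst_inv_fisher_pen\<close>). As \<open>g \<longlongrightarrow> \<infinity>\<close> the coordinates up to \<open>J\<close> do not change,
  the bias coordinates beyond \<open>J\<close> tend to those of \<open>\<theta>\<close>, and the noise coordinates beyond \<open>J\<close> tend to \<open>0\<close>.

  The factor \<open>c\<close> cancels from the noise part: the coordinate \<open>j \<le> J\<close> of the stochastic term is
  \<open>1 / N\<^sub>j\<close> times the effective noise \<open>\<omega> - U \<theta> / \<mu>\<close> tested against \<open>A e\<^sub>j\<close>, a vector of squared norm \<open>N\<^sub>j\<close>.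
  The local set forces \<open>\<parallel>\<theta>\<parallel> \<le> \<mu>\<close>, so the second moment of the effective noise in a unit direction is at most
  \<open>2 (C\<^sub>\<omega> + C\<^sub>\<nu>)\<close> (\<open>effective_noise_moment\<close>), and the limiting variance is at most
  \<open>2 (C\<^sub>\<omega> + C\<^sub>\<nu>) \<Sum>\<^sub>j\<^sub>\<le>\<^sub>J 1 / N\<^sub>j\<close>. The rate then follows by bounding this sum by its assumed order and the tail of
  \<open>\<theta>\<close> by its weighted norm.
\<close>

section \<open>Orthonormal frames\<close>

locale orthonormal_frame =
  fixes e :: "nat \<Rightarrow> real^'n"
  assumes orthonormal:
    "\<lbrakk>i \<in> {1..CARD('n)}; j \<in> {1..CARD('n)}\<rbrakk> \<Longrightarrow> e i \<bullet> e j = (if i = j then 1 else 0)"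
begin

lemma inner_combination:
  assumes "S \<subseteq> {1..CARD('n)}" "j \<in> {1..CARD('n)}"
  shows "(\<Sum>i\<in>S. a i *\<^sub>R e i) \<bullet> e j = (if j \<in> S then a j else 0)"
proof -
  have "finite S" using assms(1) by (rule finite_subset) simp
  have "(\<Sum>i\<in>S. a i *\<^sub>R e i) \<bullet> e j = (\<Sum>i\<in>S. if i = j then a i else 0)"
    unfolding inner_sum_left using assms by (intro sum.cong) (auto simp: orthonormal subset_iff)
  also have "\<dots> = (if j \<in> S then a j else 0)"
    using \<open>finite S\<close> by simp
  finally show ?thesis .
qed

lemma span_frame: "span (e ` {1..CARD('n)}) = UNIV"
proof -
  let ?B = "e ` {1..CARD('n)}"
  have inj: "inj_on e {1..CARD('n)}"
    by (rule inj_onI) (metis orthonormal zero_neq_one)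
  have "pairwise orthogonal ?B"
    by (auto simp: pairwise_def orthogonal_def orthonormal)
  moreover have "0 \<notin> ?B"
    using orthonormal by (metis imageE inner_zero_left zero_neq_one)
  ultimately have "independent ?B"
    by (rule pairwise_orthogonal_independent)
  then have "UNIV \<subseteq> span ?B"
    by (intro card_ge_dim_independent) (simp_all add: card_image[OF inj] del: One_nat_def)
  then show ?thesis by blast
qed

lemma frame_eqI:
  assumes "\<And>j. j \<in> {1..CARD('n)} \<Longrightarrow> x \<bullet> e j = y \<bullet> e j"
  shows "x = y"
proof -
  have "orthogonal (x - y) v" if "v \<in> e ` {1..CARD('n)}" for v
    using assms that by (auto simp: orthogonal_def inner_diff_left)
  then have "orthogonal (x - y) (x - y)"
    by (intro orthogonal_to_span[of "x - y" "e ` {1..CARD('n)}"]) (simp_all only: span_frame UNIV_I)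
  then show ?thesis by (simp add: orthogonal_def)
qed

lemma frame_expand: "x = (\<Sum>j=1..CARD('n). (x \<bullet> e j) *\<^sub>R e j)"
  by (rule frame_eqI) (simp only: inner_combination if_True subset_refl)

lemma inner_frame: "x \<bullet> y = (\<Sum>j=1..CARD('n). (x \<bullet> e j) * (y \<bullet> e j))"
proof -
  have "x \<bullet> y = (\<Sum>j=1..CARD('n). (x \<bullet> e j) *\<^sub>R e j) \<bullet> y"
    using frame_expand[of x] by simp
  also have "\<dots> = (\<Sum>j=1..CARD('n). (x \<bullet> e j) * (y \<bullet> e j))"
    by (simp only: inner_sum_left inner_scaleR_left inner_commute[of "e _" y])
  finally show ?thesis .
qed

lemma parseval: "(norm x)\<^sup>2 = (\<Sum>j=1..CARD('n). (x \<bullet> e j)\<^sup>2)"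
  unfolding power2_norm_eq_inner by (subst inner_frame) (simp only: power2_eq_square)

lemma trace_frame: "trace B = (\<Sum>j=1..CARD('n). e j \<bullet> (B *v e j))" for B :: "real^'n^'n"
proof -
  have "trace B = (\<Sum>i\<in>UNIV. axis i 1 \<bullet> (B *v axis i 1))"
    by (simp add: trace_def inner_axis' matrix_vector_mul_component inner_axis)
  also have "\<dots> = (\<Sum>i\<in>UNIV. \<Sum>j=1..CARD('n). (e j $ i) * ((e j v* B) $ i))"
  proof (rule sum.cong)
    fix i
    have "axis i 1 \<bullet> e j * ((B *v axis i 1) \<bullet> e j) = (e j $ i) * ((e j v* B) $ i)" for j
      by (simp add: inner_axis' inner_commute[of "B *v _"] dot_lmul_matrix[symmetric] inner_axis)
    then show "axis i 1 \<bullet> (B *v axis i 1) = (\<Sum>j=1..CARD('n). (e j $ i) * ((e j v* B) $ i))"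
      by (subst inner_frame) (simp only:)
  qed simp
  also have "\<dots> = (\<Sum>j=1..CARD('n). e j \<bullet> (B *v e j))"
    by (subst sum.swap) (simp only: inner_real_def[symmetric] inner_vec_def[symmetric] dot_lmul_matrix[symmetric] inner_commute)
  finally show ?thesis .
qed

lemma orth_proj_frame:
  assumes "J \<le> CARD('n)"
  shows "orth_proj (span (e ` {1..J})) x = (\<Sum>j=1..J. (x \<bullet> e j) *\<^sub>R e j)"
  unfolding orth_proj_def
proof (rule the_equality)
  let ?S = "span (e ` {1..J})" and ?y = "\<Sum>j=1..J. (x \<bullet> e j) *\<^sub>R e j"
  have sub: "{1..J} \<subseteq> {1..CARD('n)}" using assms by auto
  have y: "?y \<in> ?S"
    by (intro span_sum span_scale span_base) auto
  have orth: "orthogonal (x - ?y) v" if "v \<in> ?S" for v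
  proof (rule orthogonal_to_span[OF that])
    fix v assume "v \<in> e ` {1..J}"
    then obtain j where "j \<in> {1..J}" "v = e j" by blast
    moreover have "?y \<bullet> e j = x \<bullet> e j"
      using \<open>j \<in> {1..J}\<close> sub by (subst inner_combination) auto
    ultimately show "orthogonal (x - ?y) v"
      by (simp add: orthogonal_def inner_diff_left)
  qed
  show "?y \<in> ?S \<and> (\<forall>v\<in>?S. orthogonal (x - ?y) v)" using y orth by blast
  fix z assume z: "z \<in> ?S \<and> (\<forall>v\<in>?S. orthogonal (x - z) v)"
  have "z - ?y \<in> ?S" using z y by (blast intro: span_diff)
  then have "(x - ?y) \<bullet> (z - ?y) = 0" "(x - z) \<bullet> (z - ?y) = 0"
    using orth z by (auto simp: orthogonal_def)
  then have "(z - ?y) \<bullet> (z - ?y) = 0"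
    by (simp add: inner_diff_left)
  then show "z = ?y" by simp
qed

lemma norm_orth_proj_residual:
  assumes "J \<le> CARD('n)"
  shows "(norm (x - orth_proj (span (e ` {1..J})) x))\<^sup>2 = (\<Sum>j=J+1..CARD('n). (x \<bullet> e j)\<^sup>2)"
proof -
  have sub: "{1..J} \<subseteq> {1..CARD('n)}" using assms by auto
  have "(norm (x - orth_proj (span (e ` {1..J})) x))\<^sup>2
      = (\<Sum>j=1..CARD('n). if j \<in> {J+1..CARD('n)} then (x \<bullet> e j)\<^sup>2 else 0)"
    unfolding parseval orth_proj_frame[OF assms] inner_diff_left
    by (intro sum.cong refl, subst inner_combination[OF sub]) auto
  also have "\<dots> = (\<Sum>j=J+1..CARD('n). (x \<bullet> e j)\<^sup>2)"
    by (subst sum.inter_restrict[symmetric]) (auto intro: sum.cong)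
  finally show ?thesis .
qed

lemma cutoff_penalty_eigen:
  assumes "j \<in> {1..CARD('n)}"
  shows "(cutoff_penalty e J g *v x) \<bullet> e j = (if j \<le> J then 0 else g) * (x \<bullet> e j)"
proof -
  have "cutoff_penalty e J g *v x = (\<Sum>i=1..CARD('n). ((if i \<le> J then 0 else g) * (x \<bullet> e i)) *\<^sub>R e i)"
    unfolding vec_eq_iff cutoff_penalty_def matrix_vector_mult_def
    by (auto simp: sum_distrib_right sum_distrib_left inner_vec_def mult_ac
             intro!: sum.cong[THEN trans[OF sum.swap]])
  then show ?thesis using assms by (simp only: inner_combination[OF subset_refl assms] if_True)
qed

lemma inner_eigenframe:
  assumes "\<And>j. j \<in> {1..CARD('n)} \<Longrightarrow> S *v e j = l j *\<^sub>R e j" and "j \<in> {1..CARD('n)}"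
  shows "(S *v x) \<bullet> e j = l j * (x \<bullet> e j)"
proof -
  have "S *v x = S *v (\<Sum>j=1..CARD('n). (x \<bullet> e j) *\<^sub>R e j)"
    using frame_expand[of x] by simp
  also have "\<dots> = (\<Sum>j=1..CARD('n). (l j * (x \<bullet> e j)) *\<^sub>R e j)"
    unfolding linear_sum[OF matrix_vector_mul_linear]
    by (intro sum.cong refl) (simp add: matrix_vector_mult_scaleR assms(1))
  finally show ?thesis
    by (simp only: inner_combination[OF subset_refl assms(2)] assms(2) if_True)
qed

text \<open>
  The minimum in \<^const>\<open>lambda_min\<close> is only meaningful for a finite set. Testing an eigenvector
  against a frame vector that it is not orthogonal to shows that every eigenvalue is one of the \<open>l\<^sub>i\<close>.
\<close>

lemma lambda_min_le:
  assumes eig: "\<And>j. j \<in> {1..CARD('n)} \<Longrightarrow> S *v e j = l j *\<^sub>R e j" and j: "j \<in> {1..CARD('n)}"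
  shows "lambda_min S \<le> l j"
  unfolding lambda_min_def
proof (rule Min_le)
  let ?L = "{l. \<exists>v. v \<noteq> 0 \<and> S *v v = l *\<^sub>R v}"
  have "?L \<subseteq> l ` {1..CARD('n)}"
  proof
    fix r assume "r \<in> ?L"
    then obtain v where v: "v \<noteq> 0" "S *v v = r *\<^sub>R v" by blast
    then obtain i where i: "i \<in> {1..CARD('n)}" "v \<bullet> e i \<noteq> 0"
      using frame_eqI[of v 0] by auto
    have "r * (v \<bullet> e i) = l i * (v \<bullet> e i)"
      using inner_eigenframe[OF eig i(1), of v] v(2) by simp
    then show "r \<in> l ` {1..CARD('n)}" using i by simp
  qed
  then show "finite ?L" by (rule finite_subset) simp
  have "e j \<noteq> 0" using orthonormal[OF j j] by auto
  then show "l j \<in> ?L" using eig[OF j] by blast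
qed

lemma quadratic_form_ge:
  assumes eig: "\<And>j. j \<in> {1..CARD('n)} \<Longrightarrow> S *v e j = l j *\<^sub>R e j"
    and m: "\<And>j. j \<in> {1..CARD('n)} \<Longrightarrow> m \<le> l j"
  shows "m * (norm x)\<^sup>2 \<le> (S *v x) \<bullet> x"
proof -
  have "m * (norm x)\<^sup>2 = (\<Sum>j=1..CARD('n). m * (x \<bullet> e j)\<^sup>2)"
    by (simp only: parseval sum_distrib_left)
  also have "\<dots> \<le> (\<Sum>j=1..CARD('n). (S *v x) \<bullet> e j * (x \<bullet> e j))"
  proof (rule sum_mono)
    fix j assume j: "j \<in> {1..CARD('n)}"
    show "m * (x \<bullet> e j)\<^sup>2 \<le> (S *v x) \<bullet> e j * (x \<bullet> e j)"
      using mult_right_mono[OF m[OF j], of "(x \<bullet> e j)\<^sup>2"] inner_eigenframe[OF eig j, of x]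
      by (simp add: power2_eq_square mult.assoc)
  qed
  also have "\<dots> = (S *v x) \<bullet> x" by (rule inner_frame[symmetric])
  finally show ?thesis .
qed

end

lemma trace_matrix_inv_eigenframe:
  assumes "orthonormal_frame (e :: nat \<Rightarrow> real^'n)"
    and eig: "\<And>j. j \<in> {1..CARD('n)} \<Longrightarrow> S *v e j = l j *\<^sub>R e j"
    and nz: "\<And>j. j \<in> {1..CARD('n)} \<Longrightarrow> l j \<noteq> 0"
  shows "trace (matrix_inv S) = (\<Sum>j=1..CARD('n). 1 / l j)"
proof -
  interpret orthonormal_frame e by fact
  define T where "T x = (\<Sum>j=1..CARD('n). (x \<bullet> e j / l j) *\<^sub>R e j)" for x
  have "S *v (T x) = x" for x
  proof -
    have "S *v (T x) = (\<Sum>j=1..CARD('n). (x \<bullet> e j) *\<^sub>R e j)"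
      unfolding T_def linear_sum[OF matrix_vector_mul_linear] using nz
      by (intro sum.cong refl) (simp add: matrix_vector_mult_scaleR eig)
    then show ?thesis by (simp only: frame_expand[symmetric])
  qed
  then have "surj ((*v) S)" by (rule surjI)
  then have "invertible S"
    using matrix_right_invertible_surjective invertible_left_inverse matrix_left_right_inverse by blast
  then have inv: "matrix_inv S ** S = mat 1"
    unfolding invertible_def matrix_inv_def by (metis (mono_tags, lifting) someI_ex)
  have "matrix_inv S *v e j = (1 / l j) *\<^sub>R e j" if "j \<in> {1..CARD('n)}" for j
  proof -
    have "e j = matrix_inv S *v (S *v e j)" by (simp add: matrix_vector_mul_assoc inv)
    also have "\<dots> = l j *\<^sub>R (matrix_inv S *v e j)" using eig[OF that] by (simp add: matrix_vector_mult_scaleR)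
    finally show ?thesis using nz[OF that] by (metis divideR_right inverse_eq_divide)
  qed
  then show ?thesis
    by (simp add: trace_frame orthonormal)
qed

section \<open>Gradient and Hessian of the log-likelihood\<close>

definition outer :: "real^'q \<Rightarrow> real^'p \<Rightarrow> real^'p^'q" where
  "outer u v = (\<chi> i j. u $ i * v $ j)"

lemma inner_outer: "B \<bullet> outer u v = (B *v v) \<bullet> u"
  by (simp add: outer_def inner_vec_def matrix_vector_mult_def sum_distrib_left sum_distrib_right mult_ac)

lemma outer_mult_vec: "outer u v *v x = (v \<bullet> x) *\<^sub>R u"
  by (simp add: vec_eq_iff outer_def matrix_vector_mult_def inner_vec_def sum_distrib_left mult_ac)

lemma norm_outer: "norm (outer u v) = norm u * norm v"
  by (rule power2_eq_imp_eq)
     (simp_all add: power2_norm_eq_inner inner_outer outer_mult_vec power_mult_distrib)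

lemma bounded_bilinear_matrix_vector_mult:
  "bounded_bilinear (\<lambda>(A::real^'p^'q) x. A *v x)"
  unfolding bilinear_conv_bounded_bilinear[symmetric] bilinear_def
  by (auto intro!: linearI simp: matrix_vector_right_distrib matrix_vector_mult_add_rdistrib
      matrix_vector_mult_scaleR scaleR_matrix_vector_assoc[symmetric])

lemma bounded_bilinear_vector_matrix_mult:
  "bounded_bilinear (\<lambda>x (A::real^'p^'q). x v* A)"
  unfolding bilinear_conv_bounded_bilinear[symmetric] bilinear_def
  by (auto intro!: linearI simp: vector_matrix_left_distrib vector_matrix_mult_add_rdistrib
      scaleR_vector_matrix_assoc vector_scaleR_matrix_ac)

lemma bounded_bilinear_outer: "bounded_bilinear (outer :: real^'q \<Rightarrow> real^'p \<Rightarrow> _)"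
  unfolding bilinear_conv_bounded_bilinear[symmetric] bilinear_def
  by (auto intro!: linearI simp: vec_eq_iff outer_def algebra_simps)

lemmas has_derivative_matrix_products [derivative_intros] =
  bounded_bilinear.FDERIV[OF bounded_bilinear_matrix_vector_mult]
  bounded_bilinear.FDERIV[OF bounded_bilinear_vector_matrix_mult]
  bounded_bilinear.FDERIV[OF bounded_bilinear_outer]

lemma grad_eqI:
  assumes "GDERIV f x :> d"
  shows "grad f x = d"
  unfolding grad_def
proof (rule the_equality)
  fix d' assume "GDERIV f x :> d'"
  then have "(\<lambda>h. h \<bullet> d') = (\<lambda>h. h \<bullet> d)"
    using assms unfolding gderiv_def by (rule has_derivative_unique)
  then have "(d' - d) \<bullet> (d' - d) = 0"
    by (metis inner_diff_right right_minus_eq)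
  then show "d' = d" by simp
qed fact

lemma GDERIV_loglik:
  "GDERIV (loglik \<mu> b C) (\<theta>, z, A) :>
     ((z - A *v \<theta>) v* A, (b - z) - (z - A *v \<theta>), \<mu>\<^sup>2 *\<^sub>R (C - A) + outer (z - A *v \<theta>) \<theta>)"
proof -
  have eq: "loglik \<mu> b C = (\<lambda>v. - (1/2) * ((b - fst (snd v)) \<bullet> (b - fst (snd v)))
      - \<mu>\<^sup>2 / 2 * ((snd (snd v) - C) \<bullet> (snd (snd v) - C))
      - (1/2) * ((fst (snd v) - snd (snd v) *v fst v) \<bullet> (fst (snd v) - snd (snd v) *v fst v)))"
    by (auto simp: loglik_def power2_norm_eq_inner)
  show ?thesis
    unfolding gderiv_def eq
    by ((rule derivative_eq_intros refl)+,
        simp only: fun_eq_iff split_paired_All inner_Pair fst_conv snd_conv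
          inner_add_left inner_add_right inner_diff_left inner_diff_right inner_scaleR_right
          inner_outer dot_lmul_matrix dot_lmul_matrix[THEN trans[OF inner_commute]]
          matrix_vector_mult_diff_rdistrib matrix_vector_mult_diff_distrib)
       (simp add: inner_commute field_simps)
qed

lemma grad_loglik:
  "grad (loglik \<mu> b C) = (\<lambda>(\<theta>, z, A).
     ((z - A *v \<theta>) v* A, (b - z) - (z - A *v \<theta>), \<mu>\<^sup>2 *\<^sub>R (C - A) + outer (z - A *v \<theta>) \<theta>))"
  by (auto simp: grad_eqI[OF GDERIV_loglik])

text \<open>
  At a point with \<open>z = A \<theta>\<close> the derivatives of the factors \<open>A\<close> and \<open>\<theta>\<close> in the gradient are multiplied
  by the residual \<open>z - A \<theta> = 0\<close>, so only the increment \<open>\<rho>\<close> of the residual itself is left.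
\<close>

lemma hess_loglik:
  "hess (loglik \<mu> b C) (\<theta>, A *v \<theta>, A) (t, w, B) =
     (let \<rho> = w - A *v t - B *v \<theta> in (\<rho> v* A, - w - \<rho>, outer \<rho> \<theta> - \<mu>\<^sup>2 *\<^sub>R B))"
proof -
  have eq: "grad (loglik \<mu> b C) = (\<lambda>v.
     ((fst (snd v) - snd (snd v) *v fst v) v* snd (snd v),
      (b - fst (snd v)) - (fst (snd v) - snd (snd v) *v fst v),
      \<mu>\<^sup>2 *\<^sub>R (C - snd (snd v)) + outer (fst (snd v) - snd (snd v) *v fst v) (fst v)))"
    by (auto simp: grad_loglik fun_eq_iff)
  have zeros: "outer 0 v = 0" for v :: "real^'p"
    by (rule bounded_bilinear.zero_left[OF bounded_bilinear_outer])
  have "(grad (loglik \<mu> b C) has_derivative (\<lambda>(t, w, B).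
     let \<rho> = w - A *v t - B *v \<theta> in (\<rho> v* A, - w - \<rho>, outer \<rho> \<theta> - \<mu>\<^sup>2 *\<^sub>R B)))
     (at (\<theta>, A *v \<theta>, A))"
    unfolding eq
    by ((rule derivative_eq_intros refl)+)
       (simp add: fun_eq_iff Let_def zeros diff_diff_eq[symmetric])
  from frechet_derivative_at[OF this, symmetric] show ?thesis
    by (simp add: hess_def)
qed

section \<open>Expectations\<close>

context prob_space
begin

lemma integrable_of_square:
  fixes X :: "'a \<Rightarrow> 'b::euclidean_space"
  assumes [measurable]: "X \<in> borel_measurable M" and "integrable M (\<lambda>x. (norm (X x))\<^sup>2)"
  shows "integrable M X"
proof -
  have "integrable M (\<lambda>x. norm (X x))"
    by (rule square_integrable_imp_integrable[OF _ assms(2)]) measurable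
  then show ?thesis by (rule integrable_norm_cancel) fact
qed

lemma expectation_sq_dist:
  fixes X :: "'a \<Rightarrow> 'b::euclidean_space"
  assumes "X \<in> borel_measurable M" and sq: "integrable M (\<lambda>x. (norm (X x))\<^sup>2)"
  shows "integrable M (\<lambda>x. (norm (X x - c))\<^sup>2)"
    and "(\<integral>x. (norm (X x - c))\<^sup>2 \<partial>M)
       = (norm (integral\<^sup>L M X - c))\<^sup>2 + ((\<integral>x. (norm (X x))\<^sup>2 \<partial>M) - (norm (integral\<^sup>L M X))\<^sup>2)"
proof -
  have X: "integrable M X" using assms by (rule integrable_of_square)
  have eq: "(norm (X x - c))\<^sup>2 = (norm (X x))\<^sup>2 - 2 * (X x \<bullet> c) + (norm c)\<^sup>2" for x
    by (simp add: power2_norm_eq_inner inner_simps inner_commute)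
  show "integrable M (\<lambda>x. (norm (X x - c))\<^sup>2)"
    unfolding eq using X sq by (intro Bochner_Integration.integrable_add Bochner_Integration.integrable_diff) auto
  show "(\<integral>x. (norm (X x - c))\<^sup>2 \<partial>M)
       = (norm (integral\<^sup>L M X - c))\<^sup>2 + ((\<integral>x. (norm (X x))\<^sup>2 \<partial>M) - (norm (integral\<^sup>L M X))\<^sup>2)"
    unfolding eq using X sq
    by (simp add: prob_space power2_norm_eq_inner inner_simps inner_commute)
qed

text \<open>
  Averaging either data term adds the total variance of the data, which is free of the parameter.
  So gradient and Hessian of the expectation are those of the log-likelihood of the expected data.
\<close>

lemma expected_loglik_eq:
  fixes Z :: "'a \<Rightarrow> real^'q" and Ahat :: "'a \<Rightarrow> real^'p^'q"
  assumes "Z \<in> borel_measurable M" "integrable M (\<lambda>x. (norm (Z x))\<^sup>2)"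
    and "Ahat \<in> borel_measurable M" "integrable M (\<lambda>x. (norm (Ahat x))\<^sup>2)"
  obtains k where
    "expected_loglik M Z Ahat \<mu> = (\<lambda>\<upsilon>. loglik \<mu> (integral\<^sup>L M Z) (integral\<^sup>L M Ahat) \<upsilon> + k)"
proof
  show "expected_loglik M Z Ahat \<mu> = (\<lambda>\<upsilon>. loglik \<mu> (integral\<^sup>L M Z) (integral\<^sup>L M Ahat) \<upsilon>
    + (- (1/2) * ((\<integral>x. (norm (Z x))\<^sup>2 \<partial>M) - (norm (integral\<^sup>L M Z))\<^sup>2)
       - \<mu>\<^sup>2 / 2 * ((\<integral>x. (norm (Ahat x))\<^sup>2 \<partial>M) - (norm (integral\<^sup>L M Ahat))\<^sup>2)))"
    (is "_ = (\<lambda>\<upsilon>. _ + ?k)")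
  proof
    fix \<upsilon> :: "('p, 'q) param"
    obtain \<theta> z A where \<upsilon>: "\<upsilon> = (\<theta>, z, A)" by (cases \<upsilon>)
    note ints = expectation_sq_dist[OF assms(1,2), of z] expectation_sq_dist[OF assms(3,4), of A]
    have "expected_loglik M Z Ahat \<mu> \<upsilon>
      = - (1/2) * (\<integral>x. (norm (Z x - z))\<^sup>2 \<partial>M) - \<mu>\<^sup>2 / 2 * (\<integral>x. (norm (Ahat x - A))\<^sup>2 \<partial>M)
        - (1/2) * (norm (z - A *v \<theta>))\<^sup>2"
      unfolding expected_loglik_def loglik_def \<upsilon> prod.case
      unfolding norm_minus_commute[of A]
      using ints(1,3) by (simp add: prob_space)
    also have "\<dots> = loglik \<mu> (integral\<^sup>L M Z) (integral\<^sup>L M Ahat) \<upsilon> + ?k"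
      unfolding ints loglik_def \<upsilon> prod.case
      unfolding norm_minus_commute[of A] by (simp add: algebra_simps)
    finally show "expected_loglik M Z Ahat \<mu> \<upsilon> = \<dots>" .
  qed
qed

lemma score_eq:
  fixes Z :: "'a \<Rightarrow> real^'q" and Ahat :: "'a \<Rightarrow> real^'p^'q"
  assumes "Z \<in> borel_measurable M" "integrable M (\<lambda>x. (norm (Z x))\<^sup>2)"
    and "Ahat \<in> borel_measurable M" "integrable M (\<lambda>x. (norm (Ahat x))\<^sup>2)"
  shows "score M Z Ahat \<mu> \<upsilon> x
    = (0, Z x - integral\<^sup>L M Z, \<mu>\<^sup>2 *\<^sub>R (Ahat x - integral\<^sup>L M Ahat))"
proof -
  obtain k where k:
    "expected_loglik M Z Ahat \<mu> = (\<lambda>\<upsilon>. loglik \<mu> (integral\<^sup>L M Z) (integral\<^sup>L M Ahat) \<upsilon> + k)"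
    using expected_loglik_eq[OF assms] .
  obtain \<theta> z A where \<upsilon>: "\<upsilon> = (\<theta>, z, A)" by (cases \<upsilon>)
  show ?thesis
    unfolding score_def k \<upsilon>
    by (rule grad_eqI, rule GDERIV_subst, rule GDERIV_diff[OF GDERIV_loglik GDERIV_add[OF GDERIV_loglik GDERIV_const]])
       (simp add: scaleR_diff_right)
qed

lemma fisher_eq:
  fixes Z :: "'a \<Rightarrow> real^'q" and Ahat :: "'a \<Rightarrow> real^'p^'q"
  assumes "Z \<in> borel_measurable M" "integrable M (\<lambda>x. (norm (Z x))\<^sup>2)"
    and "Ahat \<in> borel_measurable M" "integrable M (\<lambda>x. (norm (Ahat x))\<^sup>2)"
  shows "fisher M Z Ahat \<mu> (\<theta>, A *v \<theta>, A) (t, w, B)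
    = (let \<rho> = w - A *v t - B *v \<theta> in (- (\<rho> v* A), w + \<rho>, \<mu>\<^sup>2 *\<^sub>R B - outer \<rho> \<theta>))"
proof -
  obtain k where k:
    "expected_loglik M Z Ahat \<mu> = (\<lambda>\<upsilon>. loglik \<mu> (integral\<^sup>L M Z) (integral\<^sup>L M Ahat) \<upsilon> + k)"
    using expected_loglik_eq[OF assms] .
  have "grad (expected_loglik M Z Ahat \<mu>) = grad (loglik \<mu> (integral\<^sup>L M Z) (integral\<^sup>L M Ahat))"
  proof
    fix \<upsilon> :: "('p, 'q) param"
    obtain \<theta> z A where \<upsilon>: "\<upsilon> = (\<theta>, z, A)" by (cases \<upsilon>)
    show "grad (expected_loglik M Z Ahat \<mu>) \<upsilon>
      = grad (loglik \<mu> (integral\<^sup>L M Z) (integral\<^sup>L M Ahat)) \<upsilon>"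
      unfolding k \<upsilon>
      by (subst grad_eqI[OF GDERIV_add[OF GDERIV_loglik GDERIV_const]])
         (simp add: grad_loglik)
  qed
  then have "fisher M Z Ahat \<mu> \<upsilon> h = - hess (loglik \<mu> (integral\<^sup>L M Z) (integral\<^sup>L M Ahat)) \<upsilon> h" for \<upsilon> h
    by (simp only: fisher_def hess_def)
  then show ?thesis by (simp add: hess_loglik Let_def)
qed

end

section \<open>Solving the penalised information equation\<close>

text \<open>
  The first component of the solution of \<open>F\<^sub>G h = (a, b, C)\<close> in the eigenbasis of \<open>A\<^sup>T A\<close>. The
  constant \<open>c\<close> collects the occurrences of the residual increment \<open>\<rho>\<close> when the increments of \<open>z\<close> and \<open>A\<close>
  are eliminated: once as itself, once through \<open>w = b - \<rho>\<close>, and \<open>\<parallel>\<theta>\<parallel>\<^sup>2 / \<mu>\<^sup>2\<close> times through \<open>B \<theta>\<close>.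
\<close>

lemma (in prob_space) fst_inv_fisher_pen:
  fixes Z :: "'a \<Rightarrow> real^'q" and Ahat :: "'a \<Rightarrow> real^'p^'q" and \<theta> :: "real^'p"
  assumes meas: "Z \<in> borel_measurable M" "integrable M (\<lambda>x. (norm (Z x))\<^sup>2)"
      "Ahat \<in> borel_measurable M" "integrable M (\<lambda>x. (norm (Ahat x))\<^sup>2)"
    and frame: "orthonormal_frame (e :: nat \<Rightarrow> real^'p)"
    and eig: "\<And>j. j \<in> {1..CARD('p)} \<Longrightarrow> (transpose A ** A) *v e j = N j *\<^sub>R e j"
    and pos: "\<And>j. j \<in> {1..CARD('p)} \<Longrightarrow> 0 < N j"
    and "\<mu> \<noteq> 0" and "0 \<le> g" and j: "j \<in> {1..CARD('p)}"
  defines "c \<equiv> 2 + (norm (\<theta> :: real^'p))\<^sup>2 / \<mu>\<^sup>2"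
  shows "fst (inv (fisher_pen M Z Ahat \<mu> (\<theta>, A *v \<theta>, A) (cutoff_penalty e J g)) (a, b, C)) \<bullet> e j
    = (c * (a \<bullet> e j) + (A *v e j) \<bullet> (b - (1 / \<mu>\<^sup>2) *\<^sub>R (C *v \<theta>)))
      / (N j + c * (if j \<le> J then 0 else g))"
proof -
  interpret orthonormal_frame e by fact
  define F where "F = fisher_pen M Z Ahat \<mu> (\<theta>, A *v \<theta>, A) (cutoff_penalty e J g)"
  define pen where "pen i = (if i \<le> J then 0 else g)" for i
  define s where "s C = (1 / \<mu>\<^sup>2) *\<^sub>R (C *v \<theta>)" for C :: "real^'p^'q"
  define sol where "sol a b C i = (c * (a \<bullet> e i) + (A *v e i) \<bullet> (b - s C)) / (N i + c * pen i)" for a b C i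
  have mu: "\<mu>\<^sup>2 > 0" using \<open>\<mu> \<noteq> 0\<close> by simp
  have c: "c \<ge> 2" unfolding c_def by simp
  have den: "N i + c * pen i > 0" if "i \<in> {1..CARD('p)}" for i
    using pos[OF that] c \<open>0 \<le> g\<close> by (simp add: pen_def add_pos_nonneg)
  have F: "F (t, w, B) = (let \<rho> = w - A *v t - B *v \<theta> in
      (cutoff_penalty e J g *v t - \<rho> v* A, w + \<rho>, \<mu>\<^sup>2 *\<^sub>R B - outer \<rho> \<theta>))" for t w B
    unfolding F_def fisher_pen_def fisher_eq[OF meas] full_penalty_def by (simp add: Let_def)
  have gram: "(A *v t) \<bullet> (A *v e i) = N i * (t \<bullet> e i)" if "i \<in> {1..CARD('p)}" for t i
    using inner_eigenframe[OF eig that, of t]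
    by (simp add: matrix_vector_mul_assoc[symmetric] dot_lmul_matrix)
  have first: "(cutoff_penalty e J g *v t - \<rho> v* A) \<bullet> e i = pen i * (t \<bullet> e i) - \<rho> \<bullet> (A *v e i)"
    if "i \<in> {1..CARD('p)}" for t \<rho> i
    using cutoff_penalty_eigen[OF that, of J g t]
    by (simp add: inner_diff_left dot_lmul_matrix pen_def)
  \<comment> \<open>With \<open>\<rho>\<close> the increment of the residual, \<open>w = b - \<rho>\<close> and \<open>B = (C + \<rho> \<theta>\<^sup>T) / \<mu>\<^sup>2\<close>; inserting both into
    the definition of \<open>\<rho>\<close> gives \<open>c \<rho> = b - A t - C \<theta> / \<mu>\<^sup>2\<close>, and \<open>\<rho>\<close> drops out of the first component.\<close>
  have unique: "t \<bullet> e j = sol a b C j" if "F (t, w, B) = (a, b, C)" for t w B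
  proof -
    define \<rho> where "\<rho> = w - A *v t - B *v \<theta>"
    have eqs: "cutoff_penalty e J g *v t - \<rho> v* A = a" "w + \<rho> = b" "\<mu>\<^sup>2 *\<^sub>R B - outer \<rho> \<theta> = C"
      using that unfolding F Let_def \<rho>_def by simp_all
    have "s C = B *v \<theta> - ((norm \<theta>)\<^sup>2 / \<mu>\<^sup>2) *\<^sub>R \<rho>"
      unfolding s_def eqs(3)[symmetric] using mu
      by (simp add: matrix_vector_mult_diff_rdistrib outer_mult_vec scaleR_matrix_vector_assoc[symmetric]
          power2_norm_eq_inner scaleR_diff_right)
    moreover have "w = \<rho> + A *v t + B *v \<theta>" by (simp add: \<rho>_def)
    ultimately have "c *\<^sub>R \<rho> = b - A *v t - s C"
      unfolding c_def eqs(2)[symmetric] by (simp add: scaleR_add_left scaleR_2)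
    then have "c * (\<rho> \<bullet> (A *v e j)) = (b - s C) \<bullet> (A *v e j) - N j * (t \<bullet> e j)"
      unfolding gram[OF j, symmetric] by (simp flip: inner_scaleR_left add: inner_diff_left)
    moreover have "c * (a \<bullet> e j) = c * (pen j * (t \<bullet> e j)) - c * (\<rho> \<bullet> (A *v e j))"
      unfolding eqs(1)[symmetric] first[OF j] by (rule right_diff_distrib)
    ultimately have "(t \<bullet> e j) * (N j + c * pen j) = c * (a \<bullet> e j) + (A *v e j) \<bullet> (b - s C)"
      by (simp add: algebra_simps inner_commute)
    then show ?thesis
      unfolding sol_def using den[OF j] by (simp add: eq_divide_eq)
  qed
  \<comment> \<open>The same elimination read backwards gives a solution for every right-hand side, so \<^const>\<open>inv\<close>
    returns a solution; its first component is the one determined above.\<close>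
  have exist: "\<exists>h. F h = (a, b, C)" for a b C
  proof -
    define t where "t = (\<Sum>i=1..CARD('p). sol a b C i *\<^sub>R e i)"
    define \<rho> where "\<rho> = (1 / c) *\<^sub>R (b - A *v t - s C)"
    define B where "B = (1 / \<mu>\<^sup>2) *\<^sub>R (C + outer \<rho> \<theta>)"
    have t: "t \<bullet> e i = sol a b C i" if "i \<in> {1..CARD('p)}" for i
      unfolding t_def by (simp only: inner_combination[OF subset_refl that] that if_True)
    have c\<rho>: "c *\<^sub>R \<rho> = b - A *v t - s C" unfolding \<rho>_def using c by simp
    have "B *v \<theta> = s C + ((norm \<theta>)\<^sup>2 / \<mu>\<^sup>2) *\<^sub>R \<rho>"
      unfolding B_def s_def
      by (simp add: matrix_vector_mult_add_rdistrib outer_mult_vec scaleR_matrix_vector_assoc[symmetric]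
          power2_norm_eq_inner scaleR_add_right)
    then have \<rho>: "(b - \<rho>) - A *v t - B *v \<theta> = \<rho>"
      using c\<rho> unfolding c_def by (simp add: algebra_simps scaleR_2)
    have "cutoff_penalty e J g *v t - \<rho> v* A = a"
    proof (rule frame_eqI)
      fix i assume i: "i \<in> {1..CARD('p)}"
      have "c * (\<rho> \<bullet> (A *v e i)) = (A *v e i) \<bullet> (b - s C) - N i * sol a b C i"
        unfolding t[OF i, symmetric] gram[OF i, symmetric]
        by (simp flip: inner_scaleR_left add: c\<rho> inner_diff_left inner_diff_right inner_commute)
      moreover have "sol a b C i * (N i + c * pen i) = c * (a \<bullet> e i) + (A *v e i) \<bullet> (b - s C)"
        unfolding sol_def using den[OF i] by simp
      ultimately have "c * (pen i * sol a b C i - \<rho> \<bullet> (A *v e i)) = c * (a \<bullet> e i)"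
        by (simp add: algebra_simps)
      then show "(cutoff_penalty e J g *v t - \<rho> v* A) \<bullet> e i = a \<bullet> e i"
        using c by (simp add: first[OF i] t[OF i])
    qed
    moreover have "\<mu>\<^sup>2 *\<^sub>R B - outer \<rho> \<theta> = C" unfolding B_def using mu by simp
    ultimately have "F (t, b - \<rho>, B) = (a, b, C)"
      by (simp add: F Let_def \<rho>)
    then show ?thesis by blast
  qed
  have "F (inv F (a, b, C)) = (a, b, C)"
    using exist by (metis f_inv_into_f rangeI)
  then have "fst (inv F (a, b, C)) \<bullet> e j = sol a b C j"
    using unique by (metis prod.collapse)
  then show ?thesis by (simp only: F_def sol_def s_def pen_def)
qed

section \<open>Second moments\<close>

context prob_space
begin

lemma Var_op_inner:
  fixes X :: "'a \<Rightarrow> 'b::euclidean_space"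
  assumes [measurable]: "X \<in> borel_measurable M" and sq: "integrable M (\<lambda>x. (norm (X x))\<^sup>2)"
  shows "integrable M (\<lambda>x. ((X x - integral\<^sup>L M X) \<bullet> h) *\<^sub>R (X x - integral\<^sup>L M X))"
    and "integrable M (\<lambda>x. ((X x - integral\<^sup>L M X) \<bullet> h)\<^sup>2)"
    and "Var_op M X h \<bullet> h = (\<integral>x. ((X x - integral\<^sup>L M X) \<bullet> h)\<^sup>2 \<partial>M)"
proof -
  let ?Y = "\<lambda>x. X x - integral\<^sup>L M X"
  have Y: "integrable M (\<lambda>x. norm h * (norm (?Y x))\<^sup>2)"
    using expectation_sq_dist(1)[OF assms] by simp
  show I: "integrable M (\<lambda>x. (?Y x \<bullet> h) *\<^sub>R ?Y x)"
  proof (rule Bochner_Integration.integrable_bound[OF Y])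
    show "AE x in M. norm ((?Y x \<bullet> h) *\<^sub>R ?Y x) \<le> norm (norm h * (norm (?Y x))\<^sup>2)"
    proof (rule AE_I2)
      fix x
      have "\<bar>?Y x \<bullet> h\<bar> * norm (?Y x) \<le> (norm (?Y x) * norm h) * norm (?Y x)"
        by (intro mult_right_mono Cauchy_Schwarz_ineq2) simp
      then show "norm ((?Y x \<bullet> h) *\<^sub>R ?Y x) \<le> norm (norm h * (norm (?Y x))\<^sup>2)"
        by (simp add: power2_eq_square mult_ac abs_mult)
    qed
  qed measurable
  have "((?Y x \<bullet> h) *\<^sub>R ?Y x) \<bullet> h = (?Y x \<bullet> h)\<^sup>2" for x by (simp add: power2_eq_square)
  then show "integrable M (\<lambda>x. (?Y x \<bullet> h)\<^sup>2)"
    and "Var_op M X h \<bullet> h = (\<integral>x. (?Y x \<bullet> h)\<^sup>2 \<partial>M)"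
    using integrable_inner_left[of h M, OF I] integral_inner_left[of h M, OF I]
    unfolding Var_op_def by simp_all
qed

lemma linear_Var_op:
  fixes X :: "'a \<Rightarrow> 'b::euclidean_space"
  assumes "X \<in> borel_measurable M" "integrable M (\<lambda>x. (norm (X x))\<^sup>2)"
  shows "linear (Var_op M X)"
proof (rule linearI)
  show "Var_op M X (h + k) = Var_op M X h + Var_op M X k" for h k
    unfolding Var_op_def inner_add_right scaleR_add_left
    by (intro Bochner_Integration.integral_add Var_op_inner(1) assms)
  show "Var_op M X (r *\<^sub>R h) = r *\<^sub>R Var_op M X h" for r h
    unfolding Var_op_def inner_scaleR_right scaleR_scaleR[symmetric]
    by (rule integral_scaleR_right) 
qed

lemma second_moment_le_onorm:
  fixes X :: "'a \<Rightarrow> 'b::euclidean_space"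
  assumes "X \<in> borel_measurable M" "integrable M (\<lambda>x. (norm (X x))\<^sup>2)"
  shows "(\<integral>x. ((X x - integral\<^sup>L M X) \<bullet> h)\<^sup>2 \<partial>M) \<le> onorm (Var_op M X) * (norm h)\<^sup>2"
proof -
  have "Var_op M X h \<bullet> h \<le> norm (Var_op M X h) * norm h"
    by (rule norm_cauchy_schwarz)
  also have "\<dots> \<le> (onorm (Var_op M X) * norm h) * norm h"
    using linear_Var_op[OF assms]
    by (intro mult_right_mono onorm) (simp_all add: linear_conv_bounded_linear)
  finally show ?thesis
    by (simp add: Var_op_inner(3)[OF assms] power2_eq_square mult_ac)
qed

lemma trace_Var_op:
  fixes X :: "'a \<Rightarrow> real^'n"
  assumes "X \<in> borel_measurable M" "integrable M (\<lambda>x. (norm (X x))\<^sup>2)"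
  shows "trace (matrix (Var_op M X)) = (\<integral>x. (norm (X x - integral\<^sup>L M X))\<^sup>2 \<partial>M)"
proof -
  have "trace (matrix (Var_op M X)) = (\<Sum>i\<in>UNIV. Var_op M X (axis i 1) \<bullet> axis i 1)"
    by (simp add: trace_def matrix_def inner_axis)
  also have "\<dots> = (\<integral>x. (\<Sum>i\<in>UNIV. ((X x - integral\<^sup>L M X) \<bullet> axis i 1)\<^sup>2) \<partial>M)"
    unfolding Var_op_inner(3)[OF assms]
    by (rule Bochner_Integration.integral_sum[symmetric]) (rule Var_op_inner(2)[OF assms])
  also have "(\<lambda>x. \<Sum>i\<in>UNIV. ((X x - integral\<^sup>L M X) \<bullet> axis i 1)\<^sup>2)
      = (\<lambda>x. (norm (X x - integral\<^sup>L M X))\<^sup>2)"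
    unfolding fun_eq_iff power2_norm_eq_inner inner_axis
    by (simp add: inner_vec_def power2_eq_square)
  finally show ?thesis .
qed

lemma onorm_Var_op_nonneg:
  fixes X :: "'a \<Rightarrow> 'b::euclidean_space"
  assumes [measurable]: "X \<in> borel_measurable M" and sq: "integrable M (\<lambda>x. (norm (X x))\<^sup>2)"
  shows "0 \<le> onorm (Var_op M X)"
  using linear_Var_op[OF assms] by (simp add: linear_conv_bounded_linear onorm_pos_le)

text \<open>
  The effective noise is \<open>\<omega> - U \<theta> / \<mu>\<close>. Its operator part tested against \<open>u\<close> is the inner product of \<open>U\<close>
  with the rank-one matrix \<open>u \<theta>\<^sup>T / \<mu>\<close>, whose Frobenius norm is at most \<open>\<parallel>u\<parallel>\<close> when \<open>\<parallel>\<theta>\<parallel> \<le> \<mu>\<close>. The factor \<open>2\<close>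
  comes from \<open>(x - y)\<^sup>2 \<le> 2 (x\<^sup>2 + y\<^sup>2)\<close>, since the two noises may be correlated.
\<close>

lemma effective_noise_moment:
  fixes Z :: "'a \<Rightarrow> real^'q" and Ahat :: "'a \<Rightarrow> real^'p^'q" and \<theta> :: "real^'p" and u :: "real^'q"
  assumes meas: "Z \<in> borel_measurable M" "integrable M (\<lambda>x. (norm (Z x))\<^sup>2)"
      "Ahat \<in> borel_measurable M" "integrable M (\<lambda>x. (norm (Ahat x))\<^sup>2)"
    and mu: "0 < \<mu>" and small: "norm \<theta> \<le> \<mu>"
    and noise_\<omega>: "onorm (Var_op M (\<lambda>x. Z x - integral\<^sup>L M Z)) \<le> C\<^sub>\<omega>"
    and noise_U: "onorm (Var_op M (\<lambda>x. \<mu> *\<^sub>R (Ahat x - integral\<^sup>L M Ahat))) \<le> C\<^sub>\<nu>"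
  defines "\<eta> \<equiv> \<lambda>x. (Z x - integral\<^sup>L M Z - (Ahat x - integral\<^sup>L M Ahat) *v \<theta>) \<bullet> u"
  shows "integrable M (\<lambda>x. (\<eta> x)\<^sup>2)"
    and "(\<integral>x. (\<eta> x)\<^sup>2 \<partial>M) \<le> 2 * (C\<^sub>\<omega> + C\<^sub>\<nu>) * (norm u)\<^sup>2"
proof -
  define Y where "Y x = Z x - integral\<^sup>L M Z" for x
  define U where "U x = \<mu> *\<^sub>R (Ahat x - integral\<^sup>L M Ahat)" for x
  define p where "p x = (Y x \<bullet> u)\<^sup>2" for x
  define q where "q x = (U x \<bullet> ((1 / \<mu>) *\<^sub>R outer u \<theta>))\<^sup>2" for x
  note [measurable] = meas(1,3)
  have Y: "Y \<in> borel_measurable M" "integrable M (\<lambda>x. (norm (Y x))\<^sup>2)" "integral\<^sup>L M Y = 0"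
    and U: "U \<in> borel_measurable M" "integrable M (\<lambda>x. (norm (U x))\<^sup>2)" "integral\<^sup>L M U = 0"
    using expectation_sq_dist(1)[OF meas(1,2)] expectation_sq_dist(1)[OF meas(3,4)]
      integrable_of_square[OF meas(1,2)] integrable_of_square[OF meas(3,4)]
    unfolding Y_def U_def by (simp_all add: prob_space power_mult_distrib)
  have onorm_Y: "onorm (Var_op M Y) \<le> C\<^sub>\<omega>"
    using noise_\<omega> unfolding Y_def[abs_def] .
  have p: "integrable M p" "(\<integral>x. p x \<partial>M) \<le> C\<^sub>\<omega> * (norm u)\<^sup>2"
    using Var_op_inner(2)[OF Y(1,2), of u] second_moment_le_onorm[OF Y(1,2), of u]
      mult_right_mono[OF onorm_Y, of "(norm u)\<^sup>2"]
    unfolding p_def[abs_def] Y(3) by simp_all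
  have onorm_U: "onorm (Var_op M U) \<le> C\<^sub>\<nu>"
    using noise_U unfolding U_def[abs_def] .
  have "0 \<le> onorm (Var_op M U)"
    by (rule onorm_Var_op_nonneg[OF U(1,2)])
  have q: "integrable M q" "(\<integral>x. q x \<partial>M) \<le> onorm (Var_op M U) * (norm ((1 / \<mu>) *\<^sub>R outer u \<theta>))\<^sup>2"
    using Var_op_inner(2)[OF U(1,2), of "(1 / \<mu>) *\<^sub>R outer u \<theta>"]
      second_moment_le_onorm[OF U(1,2), of "(1 / \<mu>) *\<^sub>R outer u \<theta>"]
    unfolding q_def[abs_def] U(3) by simp_all
  note q(2)
  also have "onorm (Var_op M U) * (norm ((1 / \<mu>) *\<^sub>R outer u \<theta>))\<^sup>2 \<le> C\<^sub>\<nu> * (norm u)\<^sup>2"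
  proof (intro mult_mono power_mono)
    have "norm u * norm \<theta> \<le> norm u * \<mu>" by (intro mult_left_mono small) simp
    then show "norm ((1 / \<mu>) *\<^sub>R outer u \<theta>) \<le> norm u"
      using mu by (simp add: norm_outer divide_simps)
    show "0 \<le> C\<^sub>\<nu>" using \<open>0 \<le> onorm (Var_op M U)\<close> onorm_U by linarith
  qed (use onorm_U in simp_all)
  finally have q': "(\<integral>x. q x \<partial>M) \<le> C\<^sub>\<nu> * (norm u)\<^sup>2" .
  have split: "\<eta> x = Y x \<bullet> u - U x \<bullet> ((1 / \<mu>) *\<^sub>R outer u \<theta>)" for x
    unfolding \<eta>_def Y_def U_def using mu by (simp add: inner_diff_left inner_outer scaleR_matrix_vector_assoc[symmetric])
  have le: "(\<eta> x)\<^sup>2 \<le> 2 * (p x + q x)" for x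
    using sum_squares_ge_zero[of "Y x \<bullet> u + U x \<bullet> ((1 / \<mu>) *\<^sub>R outer u \<theta>)" 0]
    unfolding split p_def q_def by (simp add: power2_eq_square algebra_simps)
  have meas_\<eta>: "\<eta> \<in> borel_measurable M"
    unfolding split[abs_def] using Y(1) U(1) by measurable
  have dom: "integrable M (\<lambda>x. 2 * (p x + q x))" using p(1) q(1) by simp
  show int: "integrable M (\<lambda>x. (\<eta> x)\<^sup>2)"
    using meas_\<eta> le by (intro Bochner_Integration.integrable_bound[OF dom] AE_I2) 
       (auto intro: order_trans[OF _ abs_ge_self])
  have "(\<integral>x. (\<eta> x)\<^sup>2 \<partial>M) \<le> (\<integral>x. 2 * (p x + q x) \<partial>M)"
    by (rule integral_mono[OF int dom le])
  also have "\<dots> \<le> 2 * (C\<^sub>\<omega> + C\<^sub>\<nu>) * (norm u)\<^sup>2"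
    using p q(1) q' by (simp add: algebra_simps)
  finally show "(\<integral>x. (\<eta> x)\<^sup>2 \<partial>M) \<le> 2 * (C\<^sub>\<omega> + C\<^sub>\<nu>) * (norm u)\<^sup>2" .
qed

end

section \<open>Variance and bias in the eigenbasis\<close>

lemma (in prob_space) bias_sq_cutoff:
  fixes Z :: "'a \<Rightarrow> real^'q" and Ahat :: "'a \<Rightarrow> real^'p^'q" and \<theta> :: "real^'p"
  assumes meas: "Z \<in> borel_measurable M" "integrable M (\<lambda>x. (norm (Z x))\<^sup>2)"
      "Ahat \<in> borel_measurable M" "integrable M (\<lambda>x. (norm (Ahat x))\<^sup>2)"
    and frame: "orthonormal_frame (e :: nat \<Rightarrow> real^'p)"
    and eig: "\<And>j. j \<in> {1..CARD('p)} \<Longrightarrow> (transpose A ** A) *v e j = N j *\<^sub>R e j"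
    and pos: "\<And>j. j \<in> {1..CARD('p)} \<Longrightarrow> 0 < N j"
    and "\<mu> \<noteq> 0" and "0 \<le> g"
  defines "c \<equiv> 2 + (norm (\<theta> :: real^'p))\<^sup>2 / \<mu>\<^sup>2"
  shows "bias_sq M Z Ahat \<mu> (\<theta>, A *v \<theta>, A) (cutoff_penalty e J g)
    = (\<Sum>j=1..CARD('p). (c * (if j \<le> J then 0 else g) * (\<theta> \<bullet> e j)
        / (N j + c * (if j \<le> J then 0 else g)))\<^sup>2)"
proof -
  interpret orthonormal_frame e by fact
  show ?thesis
    unfolding bias_sq_def parseval[of "fst _"] full_penalty_def prod.case c_def
    by (intro sum.cong refl)
       (simp only: fst_inv_fisher_pen[OF meas frame eig pos \<open>\<mu> \<noteq> 0\<close> \<open>0 \<le> g\<close>] cutoff_penalty_eigen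
         matrix_vector_mult_0 scaleR_zero_right diff_self inner_zero_right add_0_right mult.assoc)
qed

text \<open>
  The score \<open>(0, \<omega>, \<mu>\<^sup>2 (Ahat - E Ahat))\<close> has no first component, so in the solution formula the factor \<open>c\<close>
  survives only next to the penalty, and the numerator is the effective noise tested against \<open>A e\<^sub>j\<close>.
\<close>

lemma (in prob_space) risk_cutoff:
  fixes Z :: "'a \<Rightarrow> real^'q" and Ahat :: "'a \<Rightarrow> real^'p^'q" and \<theta> :: "real^'p"
  assumes meas: "Z \<in> borel_measurable M" "integrable M (\<lambda>x. (norm (Z x))\<^sup>2)"
      "Ahat \<in> borel_measurable M" "integrable M (\<lambda>x. (norm (Ahat x))\<^sup>2)"
    and frame: "orthonormal_frame (e :: nat \<Rightarrow> real^'p)"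
    and eig: "\<And>j. j \<in> {1..CARD('p)} \<Longrightarrow> (transpose A ** A) *v e j = N j *\<^sub>R e j"
    and pos: "\<And>j. j \<in> {1..CARD('p)} \<Longrightarrow> 0 < N j"
    and "\<mu> \<noteq> 0" and "0 \<le> g"
  defines "c \<equiv> 2 + (norm (\<theta> :: real^'p))\<^sup>2 / \<mu>\<^sup>2"
    and "\<eta> \<equiv> \<lambda>j x. (Z x - integral\<^sup>L M Z - (Ahat x - integral\<^sup>L M Ahat) *v \<theta>) \<bullet> (A *v e j)"
  assumes int: "\<And>j. j \<in> {1..CARD('p)} \<Longrightarrow> integrable M (\<lambda>x. (\<eta> j x)\<^sup>2)"
  shows "risk M Z Ahat \<mu> (\<theta>, A *v \<theta>, A) (cutoff_penalty e J g)
    = (\<Sum>j=1..CARD('p). (1 / (N j + c * (if j \<le> J then 0 else g)))\<^sup>2 * (\<integral>x. (\<eta> j x)\<^sup>2 \<partial>M))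
      + bias_sq M Z Ahat \<mu> (\<theta>, A *v \<theta>, A) (cutoff_penalty e J g)"
proof -
  interpret orthonormal_frame e by fact
  define X where "X x = fst (inv (fisher_pen M Z Ahat \<mu> (\<theta>, A *v \<theta>, A) (cutoff_penalty e J g))
    (score M Z Ahat \<mu> (\<theta>, A *v \<theta>, A) x))" for x
  define r where "r j = 1 / (N j + c * (if j \<le> J then 0 else g))" for j
  have coord: "X x \<bullet> e j = r j * \<eta> j x" if "j \<in> {1..CARD('p)}" for x j
    unfolding X_def score_eq[OF meas] r_def \<eta>_def c_def
    by (subst fst_inv_fisher_pen[OF meas frame eig pos \<open>\<mu> \<noteq> 0\<close> \<open>0 \<le> g\<close> that])
       (use \<open>\<mu> \<noteq> 0\<close> in \<open>simp_all add: scaleR_matrix_vector_assoc[symmetric] inner_commute\<close>)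
  have X: "X = (\<lambda>x. \<Sum>j=1..CARD('p). (r j * \<eta> j x) *\<^sub>R e j)"
  proof
    show "X x = (\<Sum>j=1..CARD('p). (r j * \<eta> j x) *\<^sub>R e j)" for x
      by (rule frame_eqI) (simp only: coord inner_combination[OF subset_refl] if_True)
  qed
  have norm_X: "(norm (X x))\<^sup>2 = (\<Sum>j=1..CARD('p). (r j)\<^sup>2 * (\<eta> j x)\<^sup>2)" for x
    unfolding parseval by (intro sum.cong refl) (simp only: coord power_mult_distrib)
  note [measurable] = meas(1,3)
  have intA: "integrable M (\<lambda>x. (Ahat x - integral\<^sup>L M Ahat) *v \<theta>)"
    and intA0: "(\<integral>x. (Ahat x - integral\<^sup>L M Ahat) *v \<theta> \<partial>M) = 0"
  proof -
    have bl: "bounded_linear (\<lambda>B :: real^'p^'q. B *v \<theta>)"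
      by (rule bounded_bilinear.bounded_linear_left[OF bounded_bilinear_matrix_vector_mult])
    have i: "integrable M (\<lambda>x. Ahat x - integral\<^sup>L M Ahat)"
      using integrable_of_square[OF meas(3,4)] by simp
    show "integrable M (\<lambda>x. (Ahat x - integral\<^sup>L M Ahat) *v \<theta>)"
      by (rule integrable_bounded_linear[OF bl i])
    show "(\<integral>x. (Ahat x - integral\<^sup>L M Ahat) *v \<theta> \<partial>M) = 0"
      using integral_bounded_linear[OF bl i] integrable_of_square[OF meas(3,4)]
      by (simp add: prob_space)
  qed
  have int1: "integrable M (\<eta> j)" "integral\<^sup>L M (\<eta> j) = 0" for j
    unfolding \<eta>_def using intA intA0 integrable_of_square[OF meas(1,2)]
    by (simp_all add: prob_space)
  have EX: "integral\<^sup>L M X = 0"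
    unfolding X using int1 by (subst Bochner_Integration.integral_sum) simp_all
  have measX: "X \<in> borel_measurable M"
    unfolding X using int1(1) by (intro borel_measurable_integrable Bochner_Integration.integrable_sum) simp
  have sqX: "integrable M (\<lambda>x. (norm (X x))\<^sup>2)"
    unfolding norm_X using int by (intro Bochner_Integration.integrable_sum) simp
  have "trace (matrix (Var_op M X)) = (\<Sum>j=1..CARD('p). (r j)\<^sup>2 * (\<integral>x. (\<eta> j x)\<^sup>2 \<partial>M))"
    unfolding trace_Var_op[OF measX sqX] EX diff_zero norm_X
    by (subst Bochner_Integration.integral_sum) (use int in simp_all)
  then show ?thesis
    unfolding risk_def r_def X_def[abs_def] by simp
qed

section \<open>Letting the penalty tend to infinity\<close>

lemma cutoff_shrinkage_limits:
  fixes N c t :: real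
  assumes "0 < N" "0 < c"
  shows "((\<lambda>g. 1 / (N + c * (if j \<le> J then 0 else g))) \<longlongrightarrow> (if j \<le> (J::nat) then 1 / N else 0)) at_top"
    and "((\<lambda>g. c * (if j \<le> J then 0 else g) * t / (N + c * (if j \<le> J then 0 else g)))
            \<longlongrightarrow> (if j \<le> J then 0 else t)) at_top"
proof -
  have inf: "filterlim (\<lambda>g. N + c * g) at_top at_top"
    using assms by (intro filterlim_tendsto_add_at_top[OF tendsto_const]
        filterlim_tendsto_pos_mult_at_top[OF tendsto_const] filterlim_ident)
  then have lim: "((\<lambda>g. 1 / (N + c * g)) \<longlongrightarrow> 0) at_top"
    by (rule tendsto_divide_0[OF tendsto_const filterlim_at_top_imp_at_infinity])
  then show "((\<lambda>g. 1 / (N + c * (if j \<le> J then 0 else g))) \<longlongrightarrow> (if j \<le> (J::nat) then 1 / N else 0)) at_top"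
    by simp
  have "((\<lambda>g. t - N * t * (1 / (N + c * g))) \<longlongrightarrow> t - N * t * 0) at_top"
    by (intro tendsto_intros lim)
  moreover have "eventually (\<lambda>g. t - N * t * (1 / (N + c * g)) = c * g * t / (N + c * g)) at_top"
    using eventually_ge_at_top[of 0]
  proof eventually_elim
    case (elim g)
    then have "N + c * g \<noteq> 0" using assms by (smt (verit) mult_nonneg_nonneg)
    then show ?case by (simp add: field_simps)
  qed
  ultimately have "((\<lambda>g. c * g * t / (N + c * g)) \<longlongrightarrow> t) at_top"
    by (simp add: filterlim_cong)
  then show "((\<lambda>g. c * (if j \<le> J then 0 else g) * t / (N + c * (if j \<le> J then 0 else g)))
            \<longlongrightarrow> (if j \<le> J then 0 else t)) at_top"
    by simp
qed

lemma sum_cutoff: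
  fixes f :: "nat \<Rightarrow> real"
  assumes "J \<le> p"
  shows "(\<Sum>j=1..p. if j \<le> J then f j else 0) = (\<Sum>j=1..J. f j)"
    and "(\<Sum>j=1..p. if j \<le> J then 0 else f j) = (\<Sum>j=J+1..p. f j)"
proof -
  show "(\<Sum>j=1..p. if j \<le> J then f j else 0) = (\<Sum>j=1..J. f j)"
    using assms by (intro sum.mono_neutral_cong_right) auto
  show "(\<Sum>j=1..p. if j \<le> J then 0 else f j) = (\<Sum>j=J+1..p. f j)"
    by (intro sum.mono_neutral_cong_right) auto
qed

lemma trace_cutoff_limit:
  assumes frame: "orthonormal_frame (e :: nat \<Rightarrow> real^'p)"
    and eig: "\<And>j. j \<in> {1..CARD('p)} \<Longrightarrow> S *v e j = l j *\<^sub>R e j"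
    and pos: "\<And>j. j \<in> {1..CARD('p)} \<Longrightarrow> 0 < l j"
    and J: "J \<le> CARD('p)"
  shows "((\<lambda>g. trace (matrix_inv (S + cutoff_penalty e J g))) \<longlongrightarrow> (\<Sum>j=1..J. 1 / l j)) at_top"
proof -
  interpret orthonormal_frame e by fact
  let ?pen = "\<lambda>j g. if j \<le> J then 0 else g"
  have penalty: "cutoff_penalty e J g *v e j = ?pen j g *\<^sub>R e j" if j: "j \<in> {1..CARD('p)}" for g j
  proof (rule frame_eqI)
    fix i assume i: "i \<in> {1..CARD('p)}"
    show "(cutoff_penalty e J g *v e j) \<bullet> e i = (?pen j g *\<^sub>R e j) \<bullet> e i"
      unfolding cutoff_penalty_eigen[OF i] using orthonormal[OF j i] by auto
  qed
  have "eventually (\<lambda>g. (\<Sum>j=1..CARD('p). 1 / (l j + 1 * ?pen j g))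
      = trace (matrix_inv (S + cutoff_penalty e J g))) at_top"
    using eventually_ge_at_top[of "0::real"]
  proof eventually_elim
    case (elim g)
    have "(S + cutoff_penalty e J g) *v e j = (l j + 1 * ?pen j g) *\<^sub>R e j"
      and "l j + 1 * ?pen j g \<noteq> 0" if "j \<in> {1..CARD('p)}" for j
      using pos[OF that] elim
      by (simp_all add: matrix_vector_mult_add_rdistrib eig[OF that] penalty[OF that] scaleR_add_left)
    then show ?case by (rule trace_matrix_inv_eigenframe[OF frame, symmetric])
  qed
  moreover have "((\<lambda>g. \<Sum>j=1..CARD('p). 1 / (l j + 1 * ?pen j g))
      \<longlongrightarrow> (\<Sum>j=1..CARD('p). if j \<le> J then 1 / l j else 0)) at_top"
    by (intro tendsto_sum cutoff_shrinkage_limits(1) pos zero_less_one)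
  ultimately show ?thesis
    unfolding sum_cutoff(1)[OF J] by (rule Lim_transform_eventually[rotated])
qed

lemma tail_le_of_weighted_sum:
  fixes w t :: "nat \<Rightarrow> real"
  assumes "1 \<le> J" "J \<le> p" and "\<And>j. j \<in> {1..p} \<Longrightarrow> 0 < w j"
    and "\<And>i j. 1 \<le> i \<Longrightarrow> i \<le> j \<Longrightarrow> j \<le> p \<Longrightarrow> w i \<le> w j"
    and "(\<Sum>j=1..p. (w j)\<^sup>2 * (t j)\<^sup>2) \<le> 1"
  shows "(\<Sum>j=J+1..p. (t j)\<^sup>2) \<le> 1 / (w J)\<^sup>2"
proof -
  have wJ: "0 < w J" using assms by simp
  have "(w J)\<^sup>2 * (\<Sum>j=J+1..p. (t j)\<^sup>2) \<le> (\<Sum>j=J+1..p. (w j)\<^sup>2 * (t j)\<^sup>2)"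
    unfolding sum_distrib_left using assms wJ
    by (intro sum_mono mult_right_mono power_mono) (auto intro: less_imp_le)
  also have "\<dots> \<le> (\<Sum>j=1..p. (w j)\<^sup>2 * (t j)\<^sup>2)"
    by (intro sum_mono2) auto
  also have "\<dots> \<le> 1" by fact
  finally show ?thesis using wJ by (simp add: pos_le_divide_eq mult.commute)
qed

lemma risk_rate:
  fixes S B :: real
  assumes "Risk \<le> C_risk C\<^sub>\<omega> C\<^sub>\<nu> * (\<kappa>^4 * S + B)" "0 \<le> C\<^sub>\<omega>" "0 \<le> C\<^sub>\<nu>"
    and "S \<le> C1 * a" "B \<le> b" "0 \<le> a" "0 \<le> b"
  shows "Risk \<le> C_rate \<kappa> C\<^sub>\<omega> C\<^sub>\<nu> C1 C2 * (a + b)"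
proof -
  have K: "0 \<le> C_risk C\<^sub>\<omega> C\<^sub>\<nu>" using assms by (simp add: C_risk_def)
  have "S \<le> \<bar>C1\<bar> * a"
    using assms(4) mult_right_mono[OF abs_ge_self[of C1] \<open>0 \<le> a\<close>] by linarith
  then have "\<kappa>^4 * S + B \<le> \<kappa>^4 * (\<bar>C1\<bar> * a) + b"
    using assms by (intro add_mono mult_left_mono) simp_all
  also have "\<dots> \<le> (1 + \<kappa>^4 * \<bar>C1\<bar> + \<bar>C2\<bar>) * (a + b)"
    using assms by (simp add: algebra_simps)
  finally have "C_risk C\<^sub>\<omega> C\<^sub>\<nu> * (\<kappa>^4 * S + B) \<le> C_rate \<kappa> C\<^sub>\<omega> C\<^sub>\<nu> C1 C2 * (a + b)"
    unfolding C_rate_def mult.assoc using K by (rule mult_left_mono)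
  then show ?thesis using assms(1) by linarith
qed

theorem proposition3p3:
  fixes M :: "'w measure"
    and Z :: "'w \<Rightarrow> real^'q::finite"
    and Ahat :: "'w \<Rightarrow> real^'p::finite^'q"
    and \<mu> \<delta>0 R \<kappa> C\<^sub>\<omega> C\<^sub>\<nu> :: real
    and \<theta>s :: "real^'p" and zs :: "real^'q" and As :: "real^'p^'q"
    and D :: "real^'p^'p"
    and N :: "nat \<Rightarrow> real" and e :: "nat \<Rightarrow> real^'p"
    and J :: nat
  assumes prob: "prob_space M"
    and Z_meas: "Z \<in> borel_measurable M"
    and Z_sq: "integrable M (\<lambda>x. (norm (Z x))\<^sup>2)"
    and A_meas: "Ahat \<in> borel_measurable M"
    and A_sq: "integrable M (\<lambda>x. (norm (Ahat x))\<^sup>2)"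
    and mu: "\<mu> > 0"
    and As: "As = integral\<^sup>L M Ahat"
    and zs: "zs = As *v \<theta>s"
    and EZ: "integral\<^sup>L M Z = zs"
    and D_sym: "transpose D = D"
    and D_psd: "\<forall>x. 0 \<le> x \<bullet> (D *v x)"
    and D_sq: "D ** D = transpose As ** As"
    and N_eig: "\<forall>j\<in>{1..CARD('p)}. (D ** D) *v e j = N j *\<^sub>R e j"
    and e_orth: "\<forall>i\<in>{1..CARD('p)}. \<forall>j\<in>{1..CARD('p)}. e i \<bullet> e j = (if i = j then 1 else 0)"
    and N_anti: "\<forall>i j. 1 \<le> i \<and> i \<le> j \<and> j \<le> CARD('p) \<longrightarrow> N j \<le> N i"
    and N_pos: "N CARD('p) > 0"
    and kappa: "\<kappa> = 2"
    and delta0: "\<delta>0 \<le> 1/10"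
    and R: "R = \<delta>0 * \<mu> * sqrt (lambda_min (D ** D))"
    and local: "(\<theta>s, zs, As) \<in> local_set As D \<delta>0 R"
    and noise_\<omega>: "onorm (Var_op M (\<lambda>x. Z x - integral\<^sup>L M Z)) \<le> C\<^sub>\<omega>"
    and noise_U: "onorm (Var_op M (\<lambda>x. \<mu> *\<^sub>R (Ahat x - integral\<^sup>L M Ahat))) \<le> C\<^sub>\<nu>"
    and J: "J \<le> CARD('p)"
  shows
    "((\<lambda>g2. trace (matrix_inv ((1 / \<kappa>\<^sup>2) *\<^sub>R (D ** D) + cutoff_penalty e J g2)))
        \<longlongrightarrow> \<kappa>\<^sup>2 * (\<Sum>j=1..J. 1 / N j)) at_top
     \<and> ((\<lambda>g2. bias_sq M Z Ahat \<mu> (\<theta>s, zs, As) (cutoff_penalty e J g2))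
        \<longlongrightarrow> (norm (\<theta>s - orth_proj (span (e ` {1..J})) \<theta>s))\<^sup>2) at_top
     \<and> (\<exists>Risk.
          ((\<lambda>g2. risk M Z Ahat \<mu> (\<theta>s, zs, As) (cutoff_penalty e J g2)) \<longlongrightarrow> Risk) at_top
          \<and> Risk \<le> C_risk C\<^sub>\<omega> C\<^sub>\<nu> *
              (\<kappa>^4 * (\<Sum>j=1..J. 1 / N j)
               + (norm (\<theta>s - orth_proj (span (e ` {1..J})) \<theta>s))\<^sup>2)
          \<and> (\<forall>C1 C2 w.
               1 \<le> J
               \<and> (\<forall>k\<in>{1..CARD('p)}. (\<Sum>j=1..k. 1 / N j) \<le> C1 * real k / N k)
               \<and> (\<forall>k\<in>{1..CARD('p)}. (\<Sum>j=k+1..CARD('p). N j) \<le> C2 * real k * N k)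
               \<and> (\<forall>j\<in>{1..CARD('p)}. 0 < w j)
               \<and> (\<forall>i j. 1 \<le> i \<and> i \<le> j \<and> j \<le> CARD('p) \<longrightarrow> w i \<le> w j)
               \<and> (\<Sum>j=1..CARD('p). (w j)\<^sup>2 * (\<theta>s \<bullet> e j)\<^sup>2) \<le> 1
               \<longrightarrow> Risk \<le> C_rate \<kappa> C\<^sub>\<omega> C\<^sub>\<nu> C1 C2 * (real J / N J + 1 / (w J)\<^sup>2)))"
proof -
  interpret prob_space M by fact
  interpret orthonormal_frame e using e_orth by unfold_locales auto
  let ?\<upsilon> = "(\<theta>s, As *v \<theta>s, As)" and ?G = "cutoff_penalty e J"
  let ?pen = "\<lambda>j g. if j \<le> J then 0 else g"
  let ?S = "\<Sum>j=1..J. 1 / N j"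
  let ?B = "(norm (\<theta>s - orth_proj (span (e ` {1..J})) \<theta>s))\<^sup>2"
  have frame: "orthonormal_frame e" by unfold_locales
  have p: "CARD('p) \<in> {1..CARD('p)}" by (simp add: Suc_leI)
  have eigD: "(D ** D) *v e j = N j *\<^sub>R e j" if "j \<in> {1..CARD('p)}" for j
    using N_eig that by blast
  have eig: "(transpose As ** As) *v e j = N j *\<^sub>R e j" if "j \<in> {1..CARD('p)}" for j
    using eigD[OF that] by (simp only: D_sq)
  have N_min: "N CARD('p) \<le> N j" if "j \<in> {1..CARD('p)}" for j
    using N_anti that by simp
  have pos: "0 < N j" if "j \<in> {1..CARD('p)}" for j
    using N_min[OF that] N_pos by linarith
  note meas = Z_meas Z_sq A_meas A_sq
  have "\<mu> \<noteq> 0" using mu by simp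

  \<comment> \<open>Membership in the local set gives \<open>\<surd>N\<^sub>p \<parallel>\<theta>s\<parallel> \<le> \<parallel>D \<theta>s\<parallel> \<le> R \<le> \<delta>0 \<mu> \<surd>N\<^sub>p\<close>; its bound on the operator
    distance gives the sign of \<open>\<delta>0\<close>.\<close>
  have small: "norm \<theta>s \<le> \<mu>"
  proof -
    have \<delta>: "0 \<le> \<delta>0" and D\<theta>: "norm (D *v \<theta>s) \<le> R"
      using local unfolding local_set_def by (auto intro: order_trans[OF norm_ge_zero])
    have "N CARD('p) * (norm \<theta>s)\<^sup>2 \<le> ((D ** D) *v \<theta>s) \<bullet> \<theta>s"
      by (rule quadratic_form_ge[OF eigD N_min])
    also have "\<dots> = (norm (D *v \<theta>s))\<^sup>2"
      using D_sym
      by (metis dot_lmul_matrix matrix_vector_mul_assoc power2_norm_eq_inner transpose_matrix_vector)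
    finally have "sqrt (N CARD('p)) * norm \<theta>s \<le> norm (D *v \<theta>s)"
      using N_pos by - (rule power2_le_imp_le, simp_all add: power_mult_distrib)
    also have "\<dots> \<le> \<delta>0 * \<mu> * sqrt (N CARD('p))"
      using D\<theta> lambda_min_le[OF eigD p] \<delta> mu unfolding R
      by (elim order_trans) (intro mult_left_mono real_sqrt_le_mono, auto)
    finally have "norm \<theta>s \<le> \<delta>0 * \<mu>"
      using N_pos by (simp add: mult.commute)
    also have "\<dots> \<le> 1 * \<mu>" using delta0 mu by (intro mult_right_mono) auto
    finally show ?thesis by simp
  qed

  define c where "c = 2 + (norm \<theta>s)\<^sup>2 / \<mu>\<^sup>2"
  have c: "0 < c" unfolding c_def by (simp add: add_pos_nonneg)
  define \<eta> where "\<eta> j x = (Z x - integral\<^sup>L M Z - (Ahat x - integral\<^sup>L M Ahat) *v \<theta>s) \<bullet> (As *v e j)" for j x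
  define V where "V j = (\<integral>x. (\<eta> j x)\<^sup>2 \<partial>M)" for j
  note moment = effective_noise_moment[OF meas mu small noise_\<omega> noise_U]
  have int: "integrable M (\<lambda>x. (\<eta> j x)\<^sup>2)" for j
    unfolding \<eta>_def by (rule moment(1))
  have V: "V j \<le> 2 * (C\<^sub>\<omega> + C\<^sub>\<nu>) * N j" if j: "j \<in> {1..CARD('p)}" for j
  proof -
    have "(norm (As *v e j))\<^sup>2 = ((transpose As ** As) *v e j) \<bullet> e j"
      by (simp add: power2_norm_eq_inner matrix_vector_mul_assoc[symmetric] dot_lmul_matrix)
    also have "\<dots> = N j" by (simp add: eig[OF j] orthonormal[OF j j])
    finally show ?thesis
      using moment(2)[of "As *v e j"] unfolding V_def \<eta>_def by simp
  qed

  have trace_lim: "((\<lambda>g. trace (matrix_inv ((1 / \<kappa>\<^sup>2) *\<^sub>R (D ** D) + ?G g))) \<longlongrightarrow> \<kappa>\<^sup>2 * ?S) at_top"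
  proof -
    have "((\<lambda>g. trace (matrix_inv ((1 / \<kappa>\<^sup>2) *\<^sub>R (D ** D) + ?G g)))
        \<longlongrightarrow> (\<Sum>j=1..J. 1 / (1 / \<kappa>\<^sup>2 * N j))) at_top"
      using pos kappa
      by (intro trace_cutoff_limit[OF frame _ _ J])
         (simp_all add: scaleR_matrix_vector_assoc[symmetric] eigD)
    then show ?thesis by (simp add: sum_distrib_left)
  qed

  have bias_lim: "((\<lambda>g. bias_sq M Z Ahat \<mu> ?\<upsilon> (?G g)) \<longlongrightarrow> ?B) at_top"
  proof -
    have "((\<lambda>g. \<Sum>j=1..CARD('p). (c * ?pen j g * (\<theta>s \<bullet> e j) / (N j + c * ?pen j g))\<^sup>2)
        \<longlongrightarrow> (\<Sum>j=1..CARD('p). (if j \<le> J then 0 else \<theta>s \<bullet> e j)\<^sup>2)) at_top"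
      by (intro tendsto_sum tendsto_power cutoff_shrinkage_limits(2) pos c)
    also have "(\<Sum>j=1..CARD('p). (if j \<le> J then 0 else \<theta>s \<bullet> e j)\<^sup>2) = ?B"
      unfolding norm_orth_proj_residual[OF J] sum_cutoff(2)[OF J, symmetric]
      by (intro sum.cong) auto
    finally show ?thesis
    proof (rule Lim_transform_eventually)
      show "eventually (\<lambda>g. (\<Sum>j=1..CARD('p). (c * ?pen j g * (\<theta>s \<bullet> e j) / (N j + c * ?pen j g))\<^sup>2)
          = bias_sq M Z Ahat \<mu> ?\<upsilon> (?G g)) at_top"
        using eventually_ge_at_top[of "0::real"]
        by eventually_elim (simp only: bias_sq_cutoff[OF meas frame eig pos \<open>\<mu> \<noteq> 0\<close>] c_def)
    qed
  qed

  define Risk where "Risk = (\<Sum>j=1..J. (1 / N j)\<^sup>2 * V j) + ?B"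
  have risk_lim: "((\<lambda>g. risk M Z Ahat \<mu> ?\<upsilon> (?G g)) \<longlongrightarrow> Risk) at_top"
  proof -
    have "((\<lambda>g. (\<Sum>j=1..CARD('p). (1 / (N j + c * ?pen j g))\<^sup>2 * V j) + bias_sq M Z Ahat \<mu> ?\<upsilon> (?G g))
        \<longlongrightarrow> (\<Sum>j=1..CARD('p). (if j \<le> J then 1 / N j else 0)\<^sup>2 * V j) + ?B) at_top"
      by (intro tendsto_add tendsto_sum tendsto_mult tendsto_power tendsto_const
          cutoff_shrinkage_limits(1) pos c bias_lim)
    also have "(\<Sum>j=1..CARD('p). (if j \<le> J then 1 / N j else 0)\<^sup>2 * V j) + ?B = Risk"
      unfolding Risk_def sum_cutoff(1)[OF J, symmetric]
      by (intro arg_cong2[where f="(+)"] sum.cong) auto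
    finally show ?thesis
    proof (rule Lim_transform_eventually)
      show "eventually (\<lambda>g. (\<Sum>j=1..CARD('p). (1 / (N j + c * ?pen j g))\<^sup>2 * V j)
            + bias_sq M Z Ahat \<mu> ?\<upsilon> (?G g) = risk M Z Ahat \<mu> ?\<upsilon> (?G g)) at_top"
        using eventually_ge_at_top[of "0::real"]
      proof eventually_elim
        case (elim g)
        show ?case
          unfolding V_def \<eta>_def c_def
          by (rule risk_cutoff[OF meas frame eig pos \<open>\<mu> \<noteq> 0\<close> elim int[unfolded \<eta>_def], symmetric])
      qed
    qed
  qed

  have C_nonneg: "0 \<le> C\<^sub>\<omega>" "0 \<le> C\<^sub>\<nu>"
  proof -
    note [measurable] = Z_meas A_meas
    have "0 \<le> onorm (Var_op M (\<lambda>x. Z x - integral\<^sup>L M Z))"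
      using expectation_sq_dist(1)[OF Z_meas Z_sq] by (intro onorm_Var_op_nonneg) auto
    then show "0 \<le> C\<^sub>\<omega>" using noise_\<omega> by linarith
    have "0 \<le> onorm (Var_op M (\<lambda>x. \<mu> *\<^sub>R (Ahat x - integral\<^sup>L M Ahat)))"
      using expectation_sq_dist(1)[OF A_meas A_sq]
      by (intro onorm_Var_op_nonneg) (auto simp: power_mult_distrib)
    then show "0 \<le> C\<^sub>\<nu>" using noise_U by linarith
  qed

  have S: "0 \<le> ?S" using pos J by (intro sum_nonneg) (auto simp: less_imp_le)
  have risk_bound: "Risk \<le> C_risk C\<^sub>\<omega> C\<^sub>\<nu> * (\<kappa>^4 * ?S + ?B)"
  proof -
    have "(\<Sum>j=1..J. (1 / N j)\<^sup>2 * V j) \<le> (\<Sum>j=1..J. 2 * (C\<^sub>\<omega> + C\<^sub>\<nu>) * (1 / N j))"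
    proof (rule sum_mono)
      fix j assume "j \<in> {1..J}"
      then have j: "j \<in> {1..CARD('p)}" using J by simp
      have "(1 / N j)\<^sup>2 * V j \<le> (1 / N j)\<^sup>2 * (2 * (C\<^sub>\<omega> + C\<^sub>\<nu>) * N j)"
        by (intro mult_left_mono V j) simp
      also have "\<dots> = 2 * (C\<^sub>\<omega> + C\<^sub>\<nu>) * (1 / N j)"
        using pos[OF j] by (simp add: power2_eq_square)
      finally show "(1 / N j)\<^sup>2 * V j \<le> 2 * (C\<^sub>\<omega> + C\<^sub>\<nu>) * (1 / N j)" .
    qed
    also have "\<dots> = 2 * (C\<^sub>\<omega> + C\<^sub>\<nu>) * ?S" by (simp only: sum_distrib_left)
    also have "\<dots> \<le> C_risk C\<^sub>\<omega> C\<^sub>\<nu> * (\<kappa>^4 * ?S)"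
      using C_nonneg S unfolding C_risk_def kappa by (intro mult_mono) auto
    finally have "(\<Sum>j=1..J. (1 / N j)\<^sup>2 * V j) \<le> C_risk C\<^sub>\<omega> C\<^sub>\<nu> * (\<kappa>^4 * ?S)" .
    moreover have "1 * ?B \<le> C_risk C\<^sub>\<omega> C\<^sub>\<nu> * ?B"
      using C_nonneg unfolding C_risk_def by (intro mult_right_mono) auto
    ultimately show ?thesis unfolding Risk_def distrib_left by linarith
  qed

  have rate: "Risk \<le> C_rate \<kappa> C\<^sub>\<omega> C\<^sub>\<nu> C1 C2 * (real J / N J + 1 / (w J)\<^sup>2)"
    if "1 \<le> J" and sum1: "\<forall>k\<in>{1..CARD('p)}. (\<Sum>j=1..k. 1 / N j) \<le> C1 * real k / N k"
      and w: "\<forall>j\<in>{1..CARD('p)}. 0 < w j"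
        "\<forall>i j. 1 \<le> i \<and> i \<le> j \<and> j \<le> CARD('p) \<longrightarrow> w i \<le> w j"
        "(\<Sum>j=1..CARD('p). (w j)\<^sup>2 * (\<theta>s \<bullet> e j)\<^sup>2) \<le> 1"
    for C1 C2 w
  proof (rule risk_rate[OF risk_bound C_nonneg])
    have JJ: "J \<in> {1..CARD('p)}" using \<open>1 \<le> J\<close> J by simp
    show "?S \<le> C1 * (real J / N J)" using sum1 JJ by simp
    show "?B \<le> 1 / (w J)\<^sup>2"
      unfolding norm_orth_proj_residual[OF J]
      using w by (intro tail_le_of_weighted_sum[OF \<open>1 \<le> J\<close> J]) auto
    show "0 \<le> real J / N J" using pos[OF JJ] by simp
  qed simp

  show ?thesis
    unfolding zs using trace_lim bias_lim risk_lim risk_bound rate by blast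
qed

end
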